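(* Let $G_n=G_n(w)$ be the symmetry groups of the period-doubling word $w$. Then $G_1=S_1$, $G_2=S_2$, $G_3=\{[1,2,3],[3,2,1]\}$, and for $n\geq 4$ the following recurrence relations hold: $$G_n=\begin{cases}(G_{n/2}\times G_{n/2})\rtimes S_2, & n\text{ even},\\ G_{(n-1)/2}\times G_{(n+1)/2}, & n\text{ odd},\end{cases}$$ where the groups on the right-hand side are identified with subgroups of $S_n$ as follows. For $n=2l+1$ odd, the group consists of all $g\in S_n$ for which there exist $p\in G_l$ and $h\in G_{l+1}$ with $g(2j)=2p(j)$ for $1\leq j\leq l$ and $g(2j-1)=2h(j)-1$ for $1\leq j\leq l+1$. For $n=2l$ even, the group consists of all $g\in S_n$ for which there exist $p,h\in G_l$ such that either $g(2j)=2p(j)$ and $g(2j-1)=2h(j)-1$ for all $1\leq j\leq l$, or $g(2j)=2p(j)-1$ and $g(2j-1)=2h(j)$ for all $1\leq j\leq l$.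
   Context: The period-doubling word $w=w_1w_2w_3\cdots=0100010101000100\cdots$ is the binary word in which $w_i\in\{0,1\}$, $w_i\equiv k\pmod 2$, where $i=2^kl$ with $l$ odd. $F_n(w)$ denotes the set of factors of length $n$ of $w$. A permutation $g\in S_n$ acts on a word $u=u_1\cdots u_n$ by $g(u)=u_{g^{-1}(1)}\cdots u_{g^{-1}(n)}$; the symmetry group of order $n$ of $w$ is $G_n(w)=\{\pi\in S_n \mid \pi(x)\in F_n(w)\text{ for each }x\in F_n(w)\}$. $[m_1,\ldots,m_n]$ denotes the permutation $i\mapsto m_i$. *)

theory Defs
  imports "HOL-Combinatorics.Permutations" "HOL-Computational_Algebra.Primes"
begin

text \<open>Infinite words are functions on the positive integers: the letter at index 0 is
  never used. Finite words are lists, so the letter \<open>u\<^sub>i\<close> is \<open>u ! (i - 1)\<close>.\<close>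

definition period_doubling :: "nat \<Rightarrow> nat" where
  "period_doubling i = multiplicity 2 i mod 2"

lemma period_doubling_eq:
  assumes "odd l"
  shows "period_doubling (2 ^ k * l) = k mod 2"
proof -
  have "multiplicity 2 l = 0" and "l \<noteq> 0"
    using assms by (auto intro: not_dvd_imp_multiplicity_0 elim: oddE)
  then have "multiplicity 2 (2 ^ k * l) = k"
    by (simp add: prime_elem_multiplicity_mult_distrib multiplicity_same_power)
  then show ?thesis
    by (simp add: period_doubling_def)
qed

definition factors :: "(nat \<Rightarrow> 'a) \<Rightarrow> nat \<Rightarrow> 'a list set" where
  "factors w n = {map w [i..<i + n] | i. 1 \<le> i}"

definition perm_act :: "(nat \<Rightarrow> nat) \<Rightarrow> 'a list \<Rightarrow> 'a list" where
  "perm_act g u = map (\<lambda>i. u ! (inv g i - 1)) [1..<length u + 1]"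

text \<open>\<open>S\<^sub>n\<close> is the set of permutations of \<open>{1..n}\<close>, extended by the identity
  to all natural numbers.\<close>

definition symmetric_group :: "nat \<Rightarrow> (nat \<Rightarrow> nat) set" where
  "symmetric_group n = {g. g permutes {1..n}}"

definition symmetry_group :: "(nat \<Rightarrow> 'a) \<Rightarrow> nat \<Rightarrow> (nat \<Rightarrow> nat) set" where
  "symmetry_group w n =
     {g \<in> symmetric_group n. \<forall>x \<in> factors w n. perm_act g x \<in> factors w n}"

abbreviation pd_group :: "nat \<Rightarrow> (nat \<Rightarrow> nat) set" where
  "pd_group \<equiv> symmetry_group period_doubling"

definition one_line :: "nat list \<Rightarrow> nat \<Rightarrow> nat" where
  "one_line ms i = (if i \<in> {1..length ms} then ms ! (i - 1) else i)"

text \<open>\<open>A \<times> B\<close> inside \<open>S\<^bsub>2l+1\<^esub>\<close>, for \<open>A \<subseteq> S\<^sub>l\<close> acting on the even positions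
  and \<open>B \<subseteq> S\<^bsub>l+1\<^esub>\<close> acting on the odd positions.\<close>

definition interleaved_product ::
  "nat \<Rightarrow> (nat \<Rightarrow> nat) set \<Rightarrow> (nat \<Rightarrow> nat) set \<Rightarrow> (nat \<Rightarrow> nat) set" where
  "interleaved_product l A B =
     {g \<in> symmetric_group (2 * l + 1).
        \<exists>p \<in> A. \<exists>h \<in> B.
          (\<forall>j \<in> {1..l}. g (2 * j) = 2 * p j) \<and>
          (\<forall>j \<in> {1..l + 1}. g (2 * j - 1) = 2 * h j - 1)}"

text \<open>\<open>(A \<times> A) \<rtimes> S\<^sub>2\<close> inside \<open>S\<^bsub>2l\<^esub>\<close>, for \<open>A \<subseteq> S\<^sub>l\<close>; the non-trivial element
  of \<open>S\<^sub>2\<close> exchanges the even and the odd positions.\<close>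

definition interleaved_semidirect :: "nat \<Rightarrow> (nat \<Rightarrow> nat) set \<Rightarrow> (nat \<Rightarrow> nat) set" where
  "interleaved_semidirect l A =
     {g \<in> symmetric_group (2 * l).
        \<exists>p \<in> A. \<exists>h \<in> A.
          (\<forall>j \<in> {1..l}. g (2 * j) = 2 * p j \<and> g (2 * j - 1) = 2 * h j - 1) \<or>
          (\<forall>j \<in> {1..l}. g (2 * j) = 2 * p j - 1 \<and> g (2 * j - 1) = 2 * h j)}"

end

theory Submission
  imports Defs
begin

text \<open>The word satisfies \<open>w\<^bsub>2i\<^esub> = 1 - w\<^sub>i\<close> and vanishes at odd indices, so a factor of length \<open>n\<close>
  is zero on one parity class of positions and the complement of a shorter factor on the other.
  In particular no factor has the letter 1 at positions of both parities; on the other hand the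
  positions \<open>k\<close> and \<open>k + 2\<close> both carry a 1 in some factor. Hence a symmetry maps each parity class
  onto a parity class, and it induces permutations of the two classes. Since 0000 is not a
  factor, for \<open>n \<ge> 4\<close> a factor determines its zero class, which forces these induced
  permutations to be symmetries of the shorter factors.\<close>

section \<open>Letters of the period-doubling word\<close>

lemma period_doubling_odd: "odd i \<Longrightarrow> period_doubling i = 0"
  by (simp add: period_doubling_def not_dvd_imp_multiplicity_0)

lemma period_doubling_double:
  assumes "i > 0"
  shows "period_doubling (2 * i) = 1 - period_doubling i"
proof -
  have "multiplicity 2 (2 * i) = Suc (multiplicity 2 i)"
    using assms by (intro multiplicity_times_same) auto
  then show ?thesis
    by (simp add: period_doubling_def) presburger
qed

lemma period_doubling_le_1: "period_doubling i \<le> 1"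
  unfolding period_doubling_def by presburger

text \<open>Truncated \<open>1 - x\<close> is injective on the letters 0 and 1, so an equality of
  letters can be passed in both directions between a window and its doubled indices.\<close>

lemma period_doubling_double_eq_iff:
  assumes "i > 0" "j > 0"
  shows "period_doubling (2 * i) = period_doubling (2 * j) \<longleftrightarrow> period_doubling i = period_doubling j"
  using assms period_doubling_le_1[of i] period_doubling_le_1[of j]
  by (simp add: period_doubling_double) linarith

text \<open>One of four consecutive indices is congruent to 2 modulo 4; its 2-adic valuation is
  exactly 1, so it carries the letter 1.\<close>

lemma period_doubling_no_four_zeros: "\<exists>k\<in>{1..4}. period_doubling (i + k) \<noteq> 0"
proof -
  have "\<exists>k l. k \<in> {1..4} \<and> i + k = 2 * (2 * l + 1)"
    unfolding atLeastAtMost_iff by presburger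
  then obtain k l where k: "k \<in> {1..4}" "i + k = 2 ^ 1 * (2 * l + 1)"
    by auto
  then have "period_doubling (i + k) = 1"
    using period_doubling_eq[of "2 * l + 1" 1] by simp
  with k(1) show ?thesis by (metis zero_neq_one)
qed

text \<open>The indices 16k + 6 = 2(8k + 3) and 16k + 8 = 8(2k + 1) have the odd valuations 1 and 3.
  The offset 15k + 6 places them at positions k and k + 2 without any subtraction.\<close>

lemma period_doubling_ones_at_distance_2:
  "\<exists>i. period_doubling (i + k) = 1 \<and> period_doubling (i + (k + 2)) = 1"
proof (intro exI conjI)
  have "period_doubling (2 ^ 1 * (8 * k + 3)) = 1"
    by (subst period_doubling_eq) auto
  then show "period_doubling (15 * k + 6 + k) = 1" by simp
  have "period_doubling (2 ^ 3 * (2 * k + 1)) = 1"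
    by (subst period_doubling_eq) auto
  then show "period_doubling (15 * k + 6 + (k + 2)) = 1" by simp
qed

section \<open>Symmetry groups in terms of offsets of windows\<close>

text \<open>A factor is represented by the offset i before its first letter, so its k-th letter is
  \<open>w (i + k)\<close> and i ranges over all naturals, including 0. Reading the image at
  position \<open>g k\<close> instead of k removes the inverse that occurs in
  \<open>perm_act\<close>.\<close>

lemma mem_symmetry_group_iff:
  "g \<in> symmetry_group w n \<longleftrightarrow>
     g permutes {1..n} \<and> (\<forall>i. \<exists>i'. \<forall>k\<in>{1..n}. w (i + k) = w (i' + g k))"
proof (cases "g permutes {1..n}")
  case True
  have factor_iff: "x \<in> factors w n \<longleftrightarrow>
      length x = n \<and> (\<exists>i. \<forall>k\<in>{1..n}. x ! (k - 1) = w (i + k))" for x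
  proof
    assume "x \<in> factors w n"
    then obtain i where i: "1 \<le> i" "x = map w [i..<i + n]"
      by (auto simp: factors_def)
    then have "\<forall>k\<in>{1..n}. x ! (k - 1) = w (i - 1 + k)" "length x = n" by auto
    then show "length x = n \<and> (\<exists>i. \<forall>k\<in>{1..n}. x ! (k - 1) = w (i + k))"
      by blast
  next
    assume "length x = n \<and> (\<exists>i. \<forall>k\<in>{1..n}. x ! (k - 1) = w (i + k))"
    then obtain i where i: "length x = n" "\<And>k. k \<in> {1..n} \<Longrightarrow> x ! (k - 1) = w (i + k)"
      by auto
    have "x = map w [Suc i..<Suc i + n]"
    proof (rule nth_equalityI)
      fix j assume "j < length x"
      then show "x ! j = map w [Suc i..<Suc i + n] ! j"
        using i(1) i(2)[of "Suc j"] by (simp del: upt_Suc)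
    qed (use i in simp)
    then show "x \<in> factors w n"
      unfolding factors_def by (intro CollectI exI[of _ "Suc i"]) simp
  qed
  have act: "perm_act g x ! (k - 1) = x ! (inv g k - 1)"
    if "length x = n" "k \<in> {1..n}" for x :: "'a list" and k
    using that by (auto simp: perm_act_def simp del: upt_Suc)
  have len: "length (perm_act g x) = length x" for x :: "'a list"
    by (simp add: perm_act_def del: upt_Suc)
  have inv_mem: "inv g k \<in> {1..n}" if "k \<in> {1..n}" for k
    using permutes_in_image[OF permutes_inv[OF True]] that by blast
  have mem: "g k \<in> {1..n}" if "k \<in> {1..n}" for k
    using permutes_in_image[OF True] that by blast
  have word: "map w [Suc i..<Suc i + n] \<in> factors w n" for i
    unfolding factors_def by (intro CollectI exI[of _ "Suc i"]) simp
  have "(\<forall>x\<in>factors w n. perm_act g x \<in> factors w n) \<longleftrightarrow>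
        (\<forall>i. \<exists>i'. \<forall>k\<in>{1..n}. w (i + k) = w (i' + g k))"
  proof (intro iffI allI ballI)
    fix i assume *: "\<forall>x\<in>factors w n. perm_act g x \<in> factors w n"
    let ?x = "map w [Suc i..<Suc i + n]"
    have x: "?x ! (k - 1) = w (i + k)" if "k \<in> {1..n}" for k
      using that by (auto simp del: upt_Suc)
    obtain i' where i': "\<And>k. k \<in> {1..n} \<Longrightarrow> perm_act g ?x ! (k - 1) = w (i' + k)"
      using * word factor_iff by metis
    have "w (i + k) = w (i' + g k)" if "k \<in> {1..n}" for k
      using i'[OF mem[OF that]] act[of ?x "g k"] mem[OF that] x[OF that]
      by (simp add: permutes_inverses(2)[OF True] del: upt_Suc)
    then show "\<exists>i'. \<forall>k\<in>{1..n}. w (i + k) = w (i' + g k)" by blast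
  next
    fix x assume *: "\<forall>i. \<exists>i'. \<forall>k\<in>{1..n}. w (i + k) = w (i' + g k)" and "x \<in> factors w n"
    then obtain i where x: "length x = n" "\<And>k. k \<in> {1..n} \<Longrightarrow> x ! (k - 1) = w (i + k)"
      using factor_iff by blast
    obtain i' where i': "\<And>k. k \<in> {1..n} \<Longrightarrow> w (i + k) = w (i' + g k)"
      using * by blast
    have "perm_act g x ! (k - 1) = w (i' + k)" if "k \<in> {1..n}" for k
      using act[OF x(1) that] x(2)[OF inv_mem[OF that]] i'[OF inv_mem[OF that]]
      by (simp add: permutes_inverses(1)[OF True])
    then show "perm_act g x \<in> factors w n"
      using factor_iff len x(1) by metis
  qed
  then show ?thesis
    using True by (simp add: symmetry_group_def symmetric_group_def)
qed (simp add: symmetry_group_def symmetric_group_def)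

section \<open>Symmetries and parity classes of positions\<close>

text \<open>Some factor has the letter 1 at both k and k + 2. Its image has the letter 1 at
  \<open>g k\<close> and \<open>g (k + 2)\<close>, and ones occur only at even indices of the
  word.\<close>

lemma pd_group_same_parity_step:
  assumes g: "g \<in> pd_group n" and k: "k \<in> {1..n}" "k + 2 \<in> {1..n}"
  shows "even (g (k + 2)) \<longleftrightarrow> even (g k)"
proof -
  obtain i where i: "period_doubling (i + k) = 1" "period_doubling (i + (k + 2)) = 1"
    using period_doubling_ones_at_distance_2 by blast
  obtain i' where "\<forall>k\<in>{1..n}. period_doubling (i + k) = period_doubling (i' + g k)"
    using g mem_symmetry_group_iff by blast
  with i k have "period_doubling (i' + g k) = 1" "period_doubling (i' + g (k + 2)) = 1"
    by force+
  then have "even (i' + g k)" "even (i' + g (k + 2))"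
    by (metis period_doubling_odd zero_neq_one)+
  then show ?thesis by auto
qed

lemma pd_group_parity:
  assumes g: "g \<in> pd_group n" and n: "n \<ge> 2"
  shows "(\<forall>k\<in>{1..n}. even (g k) \<longleftrightarrow> even k) \<or>
         even n \<and> (\<forall>k\<in>{1..n}. even (g k) \<longleftrightarrow> odd k)"
proof -
  have perm: "g permutes {1..n}"
    using g mem_symmetry_group_iff by blast
  \<comment> \<open>Descending in steps of 2 ends at 1 or 2, which serve as representatives of the
    two classes.\<close>
  have cls: "even (g k) \<longleftrightarrow> even (g (if even k then 2 else 1))" if "k \<in> {1..n}" for k
    using that
  proof (induction k rule: less_induct)
    case (less k)
    show ?case
    proof (cases "k \<le> 2")
      case True
      with less.prems have "k = 1 \<or> k = 2" by auto
      then show ?thesis by auto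
    next
      case False
      then have "even (g (k - 2 + 2)) \<longleftrightarrow> even (g (k - 2))"
        using less.prems by (intro pd_group_same_parity_step[OF g]) auto
      moreover have "k - 2 + 2 = k" "even (k - 2) \<longleftrightarrow> even k" "k - 2 \<in> {1..n}" "k - 2 < k"
        using False less.prems by auto
      ultimately show ?thesis using less.IH[of "k - 2"] by simp
    qed
  qed
  have surj: "\<exists>k\<in>{1..n}. g k = m" if "m \<in> {1..n}" for m
    using permutes_image[OF perm] that by (metis imageE)
  \<comment> \<open>If the parities agreed, all values of g would have one parity, although both 1
    and 2 are values.\<close>
  have "even (g 1) \<noteq> even (g 2)"
  proof
    assume eq: "even (g 1) = even (g 2)"
    obtain a b where "a \<in> {1..n}" "g a = 1" "b \<in> {1..n}" "g b = 2"
      using surj[of 1] surj[of 2] n by auto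
    with cls[of a] cls[of b] eq show False by (auto split: if_splits)
  qed
  then consider "odd (g 1)" "even (g 2)" | "even (g 1)" "odd (g 2)" by blast
  then show ?thesis
  proof cases
    case 1
    then show ?thesis using cls by (auto split: if_splits)
  next
    case 2
    then have swap: "\<forall>k\<in>{1..n}. even (g k) \<longleftrightarrow> odd k"
      using cls by (auto split: if_splits)
    \<comment> \<open>For n = 2l + 1 an exchange of the classes would inject the l + 1 odd positions
      into the l even ones; \<open>f\<close> is this injection with the even values halved.\<close>
    have "even n"
    proof (rule ccontr)
      assume "odd n"
      then obtain l where l: "n = 2 * l + 1" by (elim oddE)
      define f where "f j = g (2 * j - 1) div 2" for j
      have ev: "even (g (2 * j - 1))" "g (2 * j - 1) \<in> {1..n}" if "j \<in> {1..l + 1}" for j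
      proof -
        have j: "2 * j - 1 \<in> {1..n}" "odd (2 * j - 1)" using that l by auto
        then show "even (g (2 * j - 1))" using swap by blast
        show "g (2 * j - 1) \<in> {1..n}" using permutes_in_image[OF perm] j by blast
      qed
      have "inj_on f {1..l + 1}"
      proof (rule inj_onI)
        fix i j assume ij: "i \<in> {1..l + 1}" "j \<in> {1..l + 1}" "f i = f j"
        then have "g (2 * i - 1) = g (2 * j - 1)"
          using ev(1)[OF ij(1)] ev(1)[OF ij(2)] by (auto simp: f_def elim!: evenE)
        then have "2 * i - 1 = 2 * j - 1"
          using permutes_inj[OF perm] by (meson injD)
        with ij show "i = j" by auto
      qed
      moreover have "f ` {1..l + 1} \<subseteq> {1..l}"
      proof (rule image_subsetI)
        fix j assume "j \<in> {1..l + 1}"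
        from ev[OF this] show "f j \<in> {1..l}" by (auto simp: f_def l elim!: evenE)
      qed
      ultimately have "card {1..l + 1} \<le> card {1..l}"
        by (intro card_inj_on_le) auto
      then show False by simp
    qed
    with swap show ?thesis by blast
  qed
qed

section \<open>Passage between a window and its half-length subwords\<close>

text \<open>For \<open>e \<in> {0, 1}\<close>, the positions in \<open>{1..n}\<close> of the parity of \<open>e\<close> are \<open>2j - e\<close> with
  \<open>1 \<le> j \<le> (n + e) div 2\<close>; this says that \<open>g\<close> maps this class to the class of \<open>d\<close>, acting as \<open>p\<close>.\<close>

definition acts_on_class ::
  "nat \<Rightarrow> (nat \<Rightarrow> nat) \<Rightarrow> nat \<Rightarrow> nat \<Rightarrow> (nat \<Rightarrow> nat) \<Rightarrow> bool" where
  "acts_on_class n g e d p \<longleftrightarrow>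
     (\<forall>k\<in>{1..n}. even (g k + d) \<longleftrightarrow> even (k + e)) \<and>
     (\<forall>j\<in>{1..(n + e) div 2}. g (2 * j - e) = 2 * p j - d)"

lemma parity_class_cases:
  fixes e k n :: nat
  assumes "e \<le> 1" "k \<in> {1..n}" "even (k + e)"
  obtains j where "j \<in> {1..(n + e) div 2}" "k = 2 * j - e"
proof -
  obtain j where j: "k + e = 2 * j" using assms(3) by (elim evenE)
  have "1 \<le> j" "j \<le> (n + e) div 2" "k = 2 * j - e"
    using j assms(1,2) by auto
  then show thesis using that by simp
qed

text \<open>Only the class of positions k with i + k even carries information, and the parity e of
  the offset i selects it. There the word is the complement of a factor at offset
  \<open>i div 2\<close>, on which \<open>p\<close> acts as a symmetry. An image offset of parity d
  turns the target class into the informative one and leaves zeros elsewhere. Both \<open>d\<close>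
  and \<open>p\<close> may depend on e.\<close>

lemma pd_groupI:
  assumes perm: "g permutes {1..n}"
    and classes: "\<And>e. e \<le> 1 \<Longrightarrow> \<exists>d\<le>1. \<exists>p\<in>pd_group ((n + e) div 2). acts_on_class n g e d p"
  shows "g \<in> pd_group n"
proof -
  have "\<exists>i'. \<forall>k\<in>{1..n}. period_doubling (i + k) = period_doubling (i' + g k)" for i
  proof -
    define e a where "e = i mod 2" and "a = i div 2"
    have e: "e \<le> 1" and i: "i = 2 * a + e" by (auto simp: e_def a_def)
    obtain d p where d: "d \<le> 1" and p: "p \<in> pd_group ((n + e) div 2)"
      and act: "acts_on_class n g e d p"
      using classes[OF e] by blast
    obtain a' where a': "\<And>j. j \<in> {1..(n + e) div 2} \<Longrightarrow>
        period_doubling (a + j) = period_doubling (a' + p j)"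
      using p mem_symmetry_group_iff by metis
    have p_perm: "p permutes {1..(n + e) div 2}"
      using p mem_symmetry_group_iff by blast
    have "period_doubling (i + k) = period_doubling (2 * a' + d + g k)" if k: "k \<in> {1..n}" for k
    proof (cases "even (k + e)")
      case True
      obtain j where j: "j \<in> {1..(n + e) div 2}" "k = 2 * j - e"
        using parity_class_cases[OF e k True] by blast
      \<comment> \<open>This makes the truncated subtraction in \<open>2 * p j - d\<close>
        exact.\<close>
      have pj: "p j \<ge> 1" using permutes_in_image[OF p_perm] j(1) by force
      have gk: "g k = 2 * p j - d" using act j by (auto simp: acts_on_class_def)
      have "i + k = 2 * (a + j)" using i j e by auto
      moreover have "2 * a' + d + g k = 2 * (a' + p j)" using gk pj d by auto
      moreover have "period_doubling (2 * (a + j)) = period_doubling (2 * (a' + p j))"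
        using a'[OF j(1)] pj j(1) by (subst period_doubling_double_eq_iff) auto
      ultimately show ?thesis by (simp only:)
    next
      case False
      then have "odd (g k + d)" using act k by (auto simp: acts_on_class_def)
      then have "odd (2 * a' + d + g k)" "odd (i + k)" using False i by auto
      then show ?thesis by (simp add: period_doubling_odd)
    qed
    then show ?thesis by blast
  qed
  with perm show ?thesis using mem_symmetry_group_iff by blast
qed

text \<open>This is the converse passage. For a factor at offset a, the symmetry is applied to the
  window at offset 2a + e, which shows the complement of that factor on the class of e and zeros on
  the other. Once the image offset is known to have the parity of d, halving indices gives the image
  of the short factor. The two equations for \<open>m\<close> say that source and target class have
  the same size.\<close>

lemma pd_group_class_action:
  assumes g: "g \<in> pd_group n" and n: "n \<ge> 4" and e: "e \<le> 1" and d: "d \<le> 1"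
    and parity: "\<forall>k\<in>{1..n}. even (g k + d) \<longleftrightarrow> even (k + e)"
    and m: "(n + e) div 2 = m" "(n + d) div 2 = m"
  shows "\<exists>p\<in>pd_group m. acts_on_class n g e d p"
proof -
  have perm: "g permutes {1..n}"
    using g mem_symmetry_group_iff by blast
  \<comment> \<open>The identity outside the range makes \<open>p\<close> a permutation in the sense
    of \<open>permutes\<close>.\<close>
  define p where "p j = (if j \<in> {1..m} then (g (2 * j - e) + d) div 2 else j)" for j
  have pos: "2 * j - e \<in> {1..n}" "even (2 * j - e + e)" if "j \<in> {1..m}" for j
    using that e m by auto
  have g_eq: "g (2 * j - e) = 2 * p j - d" "p j \<in> {1..m}" if j: "j \<in> {1..m}" for j
  proof -
    have ev: "even (g (2 * j - e) + d)" using parity pos[OF j] by blast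
    have mem: "g (2 * j - e) \<in> {1..n}" using permutes_in_image[OF perm] pos[OF j] by blast
    obtain q where q: "q \<in> {1..m}" "g (2 * j - e) = 2 * q - d"
      using parity_class_cases[OF d mem ev] m(2) by blast
    then have "p j = q" using j d by (auto simp: p_def)
    with q show "g (2 * j - e) = 2 * p j - d" "p j \<in> {1..m}" by auto
  qed
  have "inj_on p {1..m}"
  proof (rule inj_onI)
    fix i j assume ij: "i \<in> {1..m}" "j \<in> {1..m}" "p i = p j"
    then have "g (2 * i - e) = g (2 * j - e)" using g_eq by simp
    then have "2 * i - e = 2 * j - e" using permutes_inj[OF perm] by (meson injD)
    with ij e show "i = j" by auto
  qed
  moreover have "p ` {1..m} \<subseteq> {1..m}" using g_eq(2) by blast
  ultimately have "bij_betw p {1..m} {1..m}"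
    by (simp add: bij_betw_def endo_inj_surj)
  then have p_perm: "p permutes {1..m}"
    by (intro bij_imp_permutes) (auto simp: p_def)
  have "\<exists>a'. \<forall>j\<in>{1..m}. period_doubling (a + j) = period_doubling (a' + p j)" for a
  proof -
    obtain i' where i': "\<And>k. k \<in> {1..n} \<Longrightarrow>
        period_doubling (2 * a + e + k) = period_doubling (i' + g k)"
      using g mem_symmetry_group_iff by metis
    \<comment> \<open>Otherwise the image would vanish on the class of d because its indices are
      odd, and on the other class because it copies zeros of the original. Since n is at least 4, it
      would begin with 0000.\<close>
    have "even (i' + d)"
    proof (rule ccontr)
      assume odd: "odd (i' + d)"
      have zero: "period_doubling (i' + g k) = 0" if k: "k \<in> {1..n}" for k
      proof (cases "even (k + e)")
        case True
        then have "even (g k + d)" using parity k by blast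
        with odd have "odd (i' + g k)" by auto
        then show ?thesis by (rule period_doubling_odd)
      next
        case False
        then have "odd (2 * a + e + k)" by auto
        with i'[OF k] show ?thesis using period_doubling_odd by metis
      qed
      obtain k' where k': "k' \<in> {1..4}" "period_doubling (i' + k') \<noteq> 0"
        using period_doubling_no_four_zeros by blast
      then have "k' \<in> g ` {1..n}" using permutes_image[OF perm] n by auto
      then obtain k where "k \<in> {1..n}" "g k = k'" by auto
      with zero[of k] k'(2) show False by simp
    qed
    then have "\<exists>a'. i' = 2 * a' + d"
      using d by presburger
    then obtain a' where a': "i' = 2 * a' + d" ..
    have "period_doubling (a + j) = period_doubling (a' + p j)" if j: "j \<in> {1..m}" for j
    proof -
      have pj: "p j \<ge> 1" using g_eq(2)[OF j] by simp
      have "2 * a + e + (2 * j - e) = 2 * (a + j)" "i' + g (2 * j - e) = 2 * (a' + p j)"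
        using g_eq(1)[OF j] a' pj j e d by auto
      then have "period_doubling (2 * (a + j)) = period_doubling (2 * (a' + p j))"
        using i'[OF pos(1)[OF j]] by simp
      then show ?thesis
        using pj j by (subst (asm) period_doubling_double_eq_iff) auto
    qed
    then show ?thesis by blast
  qed
  then have "p \<in> pd_group m" using p_perm mem_symmetry_group_iff by blast
  moreover have "acts_on_class n g e d p"
    using parity g_eq(1) m(1) by (auto simp: acts_on_class_def)
  ultimately show ?thesis by blast
qed

section \<open>The recurrences for odd and even lengths\<close>

lemma permutes_atLeast1AtMost_pos:
  fixes n j :: nat
  assumes "p permutes {1..n}" "j \<in> {1..n}"
  shows "p j > 0"
  using permutes_in_image[OF assms(1), of j] assms(2) by simp

lemma ball_parity_classesI:
  fixes n :: nat
  assumes "\<And>j. j \<in> {1..n div 2} \<Longrightarrow> P (2 * j)"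
    and "\<And>j. j \<in> {1..(n + 1) div 2} \<Longrightarrow> P (2 * j - 1)"
  shows "\<forall>k\<in>{1..n}. P k"
proof
  fix k assume k: "k \<in> {1..n}"
  show "P k"
  proof (cases "even k")
    case True
    then obtain j where "j \<in> {1..n div 2}" "k = 2 * j"
      using parity_class_cases[of 0 k n] k by auto
    with assms(1) show ?thesis by blast
  next
    case False
    then obtain j where "j \<in> {1..(n + 1) div 2}" "k = 2 * j - 1"
      using parity_class_cases[of 1 k n] k by auto
    with assms(2) show ?thesis by blast
  qed
qed

text \<open>This inclusion holds for every l; the case l = 1 also yields one inclusion for length
  3.\<close>

lemma interleaved_product_subset_pd_group:
  "interleaved_product l (pd_group l) (pd_group (l + 1)) \<subseteq> pd_group (2 * l + 1)"
proof
  fix g assume "g \<in> interleaved_product l (pd_group l) (pd_group (l + 1))"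
  then obtain p h where perm: "g permutes {1..2 * l + 1}"
    and p: "p \<in> pd_group l" and h: "h \<in> pd_group (l + 1)"
    and gp: "\<forall>j\<in>{1..l}. g (2 * j) = 2 * p j"
    and gh: "\<forall>j\<in>{1..l + 1}. g (2 * j - 1) = 2 * h j - 1"
    unfolding interleaved_product_def symmetric_group_def by blast
  have "h permutes {1..l + 1}" using h mem_symmetry_group_iff by blast
  then have h_pos: "h j > 0" if "j \<in> {1..l + 1}" for j
    using permutes_atLeast1AtMost_pos that by blast
  have "\<forall>k\<in>{1..2 * l + 1}. even (g k) \<longleftrightarrow> even k"
    using gp gh h_pos by (intro ball_parity_classesI) auto
  with gp gh have "acts_on_class (2 * l + 1) g 0 0 p" "acts_on_class (2 * l + 1) g 1 1 h"
    by (auto simp: acts_on_class_def)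
  with p h have "\<exists>d\<le>1. \<exists>p\<in>pd_group ((2 * l + 1 + e) div 2). acts_on_class (2 * l + 1) g e d p"
    if "e \<le> 1" for e
    using that by (cases "e = 0") (auto simp: le_Suc_eq)
  with perm show "g \<in> pd_group (2 * l + 1)" by (rule pd_groupI)
qed

text \<open>As in the odd case l is arbitrary, and l = 1 settles length 2.\<close>

lemma interleaved_semidirect_subset_pd_group:
  "interleaved_semidirect l (pd_group l) \<subseteq> pd_group (2 * l)"
proof
  fix g assume "g \<in> interleaved_semidirect l (pd_group l)"
  then obtain p h where perm: "g permutes {1..2 * l}"
    and p: "p \<in> pd_group l" and h: "h \<in> pd_group l"
    and cases: "(\<forall>j\<in>{1..l}. g (2 * j) = 2 * p j \<and> g (2 * j - 1) = 2 * h j - 1) \<or>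
      (\<forall>j\<in>{1..l}. g (2 * j) = 2 * p j - 1 \<and> g (2 * j - 1) = 2 * h j)"
    unfolding interleaved_semidirect_def symmetric_group_def by blast
  have "p permutes {1..l}" "h permutes {1..l}" using p h mem_symmetry_group_iff by blast+
  then have pos: "p j > 0" "h j > 0" if "j \<in> {1..l}" for j
    using permutes_atLeast1AtMost_pos that by blast+
  \<comment> \<open>The value 0 stands for preserving the classes and 1 for exchanging them; the odd
    class then goes to the class of 1 - d.\<close>
  obtain d where d: "d \<le> 1" "acts_on_class (2 * l) g 0 d p" "acts_on_class (2 * l) g 1 (1 - d) h"
    using cases
  proof
    assume *: "\<forall>j\<in>{1..l}. g (2 * j) = 2 * p j \<and> g (2 * j - 1) = 2 * h j - 1"
    then have "\<forall>k\<in>{1..2 * l}. even (g k) \<longleftrightarrow> even k"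
      using pos by (intro ball_parity_classesI) auto
    with * show thesis by (intro that[of 0]) (auto simp: acts_on_class_def)
  next
    assume *: "\<forall>j\<in>{1..l}. g (2 * j) = 2 * p j - 1 \<and> g (2 * j - 1) = 2 * h j"
    then have "\<forall>k\<in>{1..2 * l}. even (g k) \<longleftrightarrow> odd k"
      using pos by (intro ball_parity_classesI) auto
    with * show thesis by (intro that[of 1]) (auto simp: acts_on_class_def)
  qed
  have "\<exists>d\<le>1. \<exists>p\<in>pd_group ((2 * l + e) div 2). acts_on_class (2 * l) g e d p"
    if "e \<le> 1" for e
  proof (cases "e = 0")
    case True
    then show ?thesis using d p by auto
  next
    case False
    with that have "e = 1" by simp
    then show ?thesis using d h by (intro exI[of _ "1 - d"]) auto
  qed
  with perm show "g \<in> pd_group (2 * l)" by (rule pd_groupI)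
qed

lemma pd_group_odd:
  assumes "l \<ge> 2"
  shows "pd_group (2 * l + 1) = interleaved_product l (pd_group l) (pd_group (l + 1))"
proof (rule antisym[OF subsetI interleaved_product_subset_pd_group])
  fix g assume g: "g \<in> pd_group (2 * l + 1)"
  \<comment> \<open>The length is odd, so the classes cannot be exchanged.\<close>
  have parity: "\<forall>k\<in>{1..2 * l + 1}. even (g k) \<longleftrightarrow> even k"
    using pd_group_parity[OF g] assms by auto
  obtain p where p: "p \<in> pd_group l" "acts_on_class (2 * l + 1) g 0 0 p"
    using pd_group_class_action[OF g, of 0 0 l] parity assms by auto
  obtain h where h: "h \<in> pd_group (l + 1)" "acts_on_class (2 * l + 1) g 1 1 h"
    using pd_group_class_action[OF g, of 1 1 "l + 1"] parity assms by auto
  have "g \<in> symmetric_group (2 * l + 1)"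
    using g by (simp add: symmetry_group_def)
  with p h show "g \<in> interleaved_product l (pd_group l) (pd_group (l + 1))"
    unfolding interleaved_product_def acts_on_class_def by auto
qed

lemma pd_group_even:
  assumes "l \<ge> 2"
  shows "pd_group (2 * l) = interleaved_semidirect l (pd_group l)"
proof (rule antisym[OF subsetI interleaved_semidirect_subset_pd_group])
  fix g assume g: "g \<in> pd_group (2 * l)"
  have sym: "g \<in> symmetric_group (2 * l)"
    using g by (simp add: symmetry_group_def)
  \<comment> \<open>Again d records whether the classes are preserved or exchanged. Each has l
    positions, so both cases meet the size condition of
    \<open>pd_group_class_action\<close>.\<close>
  obtain d where d: "d \<le> 1" "\<forall>k\<in>{1..2 * l}. even (g k + d) \<longleftrightarrow> even k"
  proof -
    have "2 * l \<ge> 2" using assms by simp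
    from pd_group_parity[OF g this]
    consider "\<forall>k\<in>{1..2 * l}. even (g k) \<longleftrightarrow> even k" | "\<forall>k\<in>{1..2 * l}. even (g k) \<longleftrightarrow> odd k"
      by blast
    then show thesis
    proof cases
      case 1
      then show ?thesis by (intro that[of 0]) auto
    next
      case 2
      then show ?thesis by (intro that[of 1]) auto
    qed
  qed
  have d': "d = 0 \<or> d = 1" using d(1) by auto
  have parity: "\<forall>k\<in>{1..2 * l}. even (g k + (1 - d)) \<longleftrightarrow> even (k + 1)"
    using d(2) d' by auto
  obtain p where p: "p \<in> pd_group l" "acts_on_class (2 * l) g 0 d p"
    using pd_group_class_action[OF g, of 0 d l] d d' assms by auto
  obtain h where h: "h \<in> pd_group l" "acts_on_class (2 * l) g 1 (1 - d) h"
    using pd_group_class_action[OF g, of 1 "1 - d" l] parity d' assms by auto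
  have "(\<forall>j\<in>{1..l}. g (2 * j) = 2 * p j \<and> g (2 * j - 1) = 2 * h j - 1) \<or>
        (\<forall>j\<in>{1..l}. g (2 * j) = 2 * p j - 1 \<and> g (2 * j - 1) = 2 * h j)"
    using p(2) h(2) d' unfolding acts_on_class_def by auto
  with sym p(1) h(1) show "g \<in> interleaved_semidirect l (pd_group l)"
    unfolding interleaved_semidirect_def by blast
qed

section \<open>The groups for lengths 1, 2 and 3\<close>

lemma pd_group_1: "pd_group 1 = symmetric_group 1"
  by (auto simp: set_eq_iff mem_symmetry_group_iff symmetric_group_def)

lemma permutes_1_2:
  assumes "g permutes {1..2::nat}"
  shows "g = id \<or> g = transpose 1 2"
proof -
  have "{1..2} = {1, 2::nat}" by auto
  with assms show ?thesis by (simp add: permutes_doubleton_iff)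
qed

lemma pd_group_2: "pd_group 2 = symmetric_group 2"
proof
  have id: "id \<in> pd_group 1"
    unfolding pd_group_1 by (simp add: symmetric_group_def permutes_id)
  show "symmetric_group 2 \<subseteq> pd_group 2"
  proof
    fix g assume g: "g \<in> symmetric_group 2"
    then have "g = id \<or> g = transpose 1 2"
      using permutes_1_2 by (simp add: symmetric_group_def)
    \<comment> \<open>With both components the identity, the first alternative gives the identity
      and the second the transposition.\<close>
    then have "g \<in> interleaved_semidirect 1 (pd_group 1)"
      unfolding interleaved_semidirect_def
      using g id by (auto intro!: bexI[of _ id])
    then show "g \<in> pd_group 2"
      using interleaved_semidirect_subset_pd_group[of 1] by auto
  qed
qed (simp add: symmetry_group_def)

text \<open>Parity alone gives the upper bound: for odd length the classes are preserved, so 2 is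
  fixed and 1, 3 are fixed or exchanged. Both permutations arise from the product with l = 1,
  because the group for length 2 is all of S_2.\<close>

lemma pd_group_3: "pd_group 3 = {one_line [1, 2, 3], one_line [3, 2, 1]}"
proof
  have range3: "k \<in> {1..3} \<longleftrightarrow> k = 1 \<or> k = 2 \<or> k = 3" for k :: nat by auto
  have lines: "one_line [1, 2, 3] = id" "one_line [3, 2, 1] = transpose 1 3"
    by (auto simp: fun_eq_iff one_line_def range3 transpose_def nth_Cons' )
  show "{one_line [1, 2, 3], one_line [3, 2, 1]} \<subseteq> pd_group 3"
  proof
    fix g assume "g \<in> {one_line [1, 2, 3], one_line [3, 2, 1]}"
    then have g: "g = id \<or> g = transpose 1 3" unfolding lines by blast
    then obtain h where h: "h permutes {1..2}" "\<forall>j\<in>{1..2}. g (2 * j - 1) = 2 * h j - 1"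
    proof
      assume "g = id"
      then show thesis by (intro that[of id]) (auto simp: permutes_id)
    next
      assume "g = transpose 1 3"
      then show thesis
        \<comment> \<open>The odd positions 1 and 3 are the first and second of their class.\<close>
        by (intro that[of "transpose 1 2"]) (auto simp: permutes_swap_id transpose_def)
    qed
    have "2 * 1 + 1 = (3::nat)" by simp
    moreover have "g permutes {1..3}"
      using g by (auto simp: permutes_id permutes_swap_id)
    ultimately have "g \<in> symmetric_group (2 * 1 + 1)"
      unfolding symmetric_group_def by (simp only: mem_Collect_eq)
    moreover have "id \<in> pd_group 1"
      unfolding pd_group_1 by (simp add: symmetric_group_def permutes_id)
    moreover have "h \<in> pd_group 2"
      using h(1) by (simp add: pd_group_2 symmetric_group_def)
    moreover have "\<forall>j\<in>{1..1}. g (2 * j) = 2 * id j"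
      using g by auto
    moreover have "\<forall>j\<in>{1..1 + 1}. g (2 * j - 1) = 2 * h j - 1"
      using h(2) by (simp only: one_add_one)
    ultimately have "g \<in> interleaved_product 1 (pd_group 1) (pd_group 2)"
      unfolding interleaved_product_def by blast
    then have "g \<in> interleaved_product 1 (pd_group 1) (pd_group (1 + 1))"
      by (simp only: one_add_one)
    then show "g \<in> pd_group 3"
      using interleaved_product_subset_pd_group[of 1] by auto
  qed
  show "pd_group 3 \<subseteq> {one_line [1, 2, 3], one_line [3, 2, 1]}"
  proof
    fix g assume g: "g \<in> pd_group 3"
    then have perm: "g permutes {1..3}" using mem_symmetry_group_iff by blast
    have mem: "g k = 1 \<or> g k = 2 \<or> g k = 3" if "k \<in> {1..3}" for k
      using permutes_in_image[OF perm, of k] that range3[of "g k"] by blast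
    have parity: "even (g k) \<longleftrightarrow> even k" if "k \<in> {1..3}" for k
      using pd_group_parity[OF g] that by auto
    have "g 1 \<noteq> 2" "g 2 \<noteq> 1" "g 2 \<noteq> 3" "g 3 \<noteq> 2"
      using parity[of 1] parity[of 2] parity[of 3] by auto
    then have g2: "g 2 = 2" and g13: "g 1 = 1 \<or> g 1 = 3" "g 3 = 1 \<or> g 3 = 3"
      using mem[of 1] mem[of 2] mem[of 3] by simp_all
    have "g 1 \<noteq> g 3" using injD[OF permutes_inj[OF perm], of 1 3] by auto
    with g13 consider "g 1 = 1" "g 3 = 3" | "g 1 = 3" "g 3 = 1" by force
    then have "g = id \<or> g = transpose 1 3"
    proof cases
      case 1
      with g2 have "g k = id k" for k
        using permutes_not_in[OF perm, of k] range3[of k] by auto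
      then show ?thesis by blast
    next
      case 2
      with g2 have "g k = transpose 1 3 k" for k
        using permutes_not_in[OF perm, of k] range3[of k] by (auto simp: transpose_def)
      then show ?thesis by blast
    qed
    then show "g \<in> {one_line [1, 2, 3], one_line [3, 2, 1]}" unfolding lines by blast
  qed
qed

theorem theorem4:
  shows "pd_group 1 = symmetric_group 1 \<and>
         pd_group 2 = symmetric_group 2 \<and>
         pd_group 3 = {one_line [1, 2, 3], one_line [3, 2, 1]} \<and>
         (\<forall>n\<ge>4. pd_group n =
            (if even n then interleaved_semidirect (n div 2) (pd_group (n div 2))
             else interleaved_product ((n - 1) div 2)
                    (pd_group ((n - 1) div 2)) (pd_group ((n + 1) div 2))))"
proof (intro conjI allI impI)
  fix n :: nat assume n: "n \<ge> 4"
  show "pd_group n =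
            (if even n then interleaved_semidirect (n div 2) (pd_group (n div 2))
             else interleaved_product ((n - 1) div 2)
                    (pd_group ((n - 1) div 2)) (pd_group ((n + 1) div 2)))"
  proof (cases "even n")
    case True
    then obtain l where "n = 2 * l" by (elim evenE)
    with n pd_group_even[of l] show ?thesis by simp
  next
    case False
    then obtain l where "n = 2 * l + 1" by (elim oddE)
    with n pd_group_odd[of l] show ?thesis by simp
  qed
qed (fact pd_group_1 pd_group_2 pd_group_3)+

end
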